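(* Let $G$ and $H$ be controllable graphs on $n$ vertices with extended walk matrices $\widehat{W}_G$ and $\widehat{W}_H$. If there exists an $n\times n$ permutation matrix $P$ such that $P\widehat{W}_G=\widehat{W}_H$ (that is, the extended walk matrices are equal up to a permutation of the rows), then $G$ and $H$ are isomorphic.
   Context: All graphs are finite and simple. For a graph $G$ on $n$ vertices with adjacency matrix $A$, let $\mathbf{1}$ be the all-ones vector in $\mathbb{R}^n$. The walk matrix of $G$ is the $n\times n$ matrix $W_G=\big[\mathbf{1}\ \ A\mathbf{1}\ \cdots\ A^{n-1}\mathbf{1}\big]$, and $G$ is controllable if $W_G$ is invertible. The extended walk matrix of $G$ is the $n\times(n+1)$ matrix $\widehat{W}_G=\big[\mathbf{1}\ \ A\mathbf{1}\ \cdots\ A^{n}\mathbf{1}\big]$. *)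

theory Defs
  imports "Graph_Theory.Graph_Theory" "Jordan_Normal_Form.Matrix"
begin

text \<open>
  Finite simple graphs are the finite, loop-free, symmetric digraphs without multiple arcs of
  the locale \<^locale>\<open>graph\<close>. The rows and columns of an adjacency matrix are
  indexed by numbers, so the matrix depends on a numbering of the vertices, which is given as a
  duplicate-free list of them. Passing to another numbering permutes the rows of the walk
  matrices; in particular it does not affect whether the walk matrix is invertible.
\<close>

definition vertex_numbering :: "'a list \<Rightarrow> ('a, 'b) pre_digraph \<Rightarrow> bool" where
  "vertex_numbering vs G \<longleftrightarrow> distinct vs \<and> set vs = verts G"

definition adjacency_mat :: "'a list \<Rightarrow> ('a, 'b) pre_digraph \<Rightarrow> real mat" where
  "adjacency_mat vs G =
     mat (length vs) (length vs) (\<lambda>(i, j). if vs ! i \<rightarrow>\<^bsub>G\<^esub> vs ! j then 1 else 0)"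

definition all_ones_vec :: "nat \<Rightarrow> real vec" where
  "all_ones_vec n = vec n (\<lambda>_. 1)"

definition walk_mat :: "'a list \<Rightarrow> ('a, 'b) pre_digraph \<Rightarrow> real mat" where
  "walk_mat vs G = mat_of_cols (length vs)
     (map (\<lambda>k. adjacency_mat vs G ^\<^sub>m k *\<^sub>v all_ones_vec (length vs)) [0..<length vs])"

definition extended_walk_mat :: "'a list \<Rightarrow> ('a, 'b) pre_digraph \<Rightarrow> real mat" where
  "extended_walk_mat vs G = mat_of_cols (length vs)
     (map (\<lambda>k. adjacency_mat vs G ^\<^sub>m k *\<^sub>v all_ones_vec (length vs)) [0..<length vs + 1])"

definition controllable :: "'a list \<Rightarrow> ('a, 'b) pre_digraph \<Rightarrow> bool" where
  "controllable vs G \<longleftrightarrow> invertible_mat (walk_mat vs G)"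

definition permutation_mat :: "nat \<Rightarrow> real mat \<Rightarrow> bool" where
  "permutation_mat n P \<longleftrightarrow>
     (\<exists>p. p permutes {..<n} \<and> P = mat n n (\<lambda>(i, j). if j = p i then 1 else 0))"

end

(*
  If P maps A^k 1 to B^k 1 for all k <= n, then for k < n it satisfies
  P A (A^k 1) = B^(k+1) 1 = B P (A^k 1). By controllability the vectors A^k 1 with k < n
  span the whole space, hence P A = B P.
*)
theory Submission
  imports Defs
begin

text \<open>Matrix powers recurse by multiplying on the right; this form puts the extra factor on
  the left, so that it can be applied after \<open>A ^\<^sub>m k *\<^sub>v v\<close>.\<close>

lemma pow_mat_Suc_left:
  fixes A :: "'a :: semiring_1 mat"
  assumes A: "A \<in> carrier_mat n n"
  shows "A ^\<^sub>m Suc k = A * A ^\<^sub>m k"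
proof (induction k)
  case (Suc k)
  have "A ^\<^sub>m Suc (Suc k) = A * A ^\<^sub>m k * A"
    using Suc by simp
  also have "\<dots> = A * A ^\<^sub>m Suc k"
    using assoc_mult_mat[OF A pow_carrier_mat[OF A] A] by simp
  finally show ?case .
qed (use A in simp)

text \<open>Agreement on a spanning family is expressed as \<open>P * A * W = B * P * W\<close>,
  with the Krylov vectors as columns of \<open>W\<close>; a right inverse of \<open>W\<close> then
  cancels it. Nothing is subtracted and no dimension is counted, so the argument works over any
  semiring.\<close>

lemma intertwining_of_krylov:
  fixes A B P :: "'a :: semiring_1 mat"
  assumes A: "A \<in> carrier_mat n n" and B: "B \<in> carrier_mat n n" and P: "P \<in> carrier_mat n n"
    and v: "v \<in> carrier_vec n" and w: "w \<in> carrier_vec n"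
    and inv: "invertible_mat (mat_of_cols n (map (\<lambda>k. A ^\<^sub>m k *\<^sub>v v) [0..<n]))"
    and krylov: "\<And>k. k \<le> n \<Longrightarrow> P *\<^sub>v (A ^\<^sub>m k *\<^sub>v v) = B ^\<^sub>m k *\<^sub>v w"
  shows "P * A = B * P"
proof -
  define W where "W = mat_of_cols n (map (\<lambda>k. A ^\<^sub>m k *\<^sub>v v) [0..<n])"
  have W: "W \<in> carrier_mat n n"
    unfolding W_def by (metis mat_of_cols_carrier(1) length_map length_upt minus_nat.diff_0)
  have Av: "A ^\<^sub>m k *\<^sub>v v \<in> carrier_vec n" for k
    using mult_mat_vec_carrier[OF pow_carrier_mat[OF A] v] .
  have col_W: "col W k = A ^\<^sub>m k *\<^sub>v v" if "k < n" for k
    unfolding W_def using that Av by (subst col_mat_of_cols) auto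
  have PA: "P * A \<in> carrier_mat n n" and BP: "B * P \<in> carrier_mat n n"
    using A B P by auto
  have "P * A * W = B * P * W"
  proof (rule mat_col_eqI)
    fix k assume "k < dim_col (B * P * W)"
    then have k: "k < n" using W by simp
    have "col (P * A * W) k = P *\<^sub>v (A *\<^sub>v (A ^\<^sub>m k *\<^sub>v v))"
      using col_mult2[OF PA W k] assoc_mult_mat_vec[OF P A Av] col_W[OF k] by simp
    also have "\<dots> = P *\<^sub>v (A ^\<^sub>m Suc k *\<^sub>v v)"
      using assoc_mult_mat_vec[OF A pow_carrier_mat[OF A] v]
      by (simp only: pow_mat_Suc_left[OF A])
    \<comment> \<open>For the last column, \<open>k = n - 1\<close>, this uses the hypothesis at
      exponent \<open>n\<close>: here the extra column of the extended walk matrix enters.\<close>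
    also have "\<dots> = B ^\<^sub>m Suc k *\<^sub>v w"
      using k by (intro krylov) simp
    also have "\<dots> = B *\<^sub>v (B ^\<^sub>m k *\<^sub>v w)"
      using assoc_mult_mat_vec[OF B pow_carrier_mat[OF B] w]
      by (simp only: pow_mat_Suc_left[OF B])
    also have "\<dots> = B *\<^sub>v (P *\<^sub>v (A ^\<^sub>m k *\<^sub>v v))"
      using krylov k by simp
    also have "\<dots> = col (B * P * W) k"
      using col_mult2[OF BP W k] assoc_mult_mat_vec[OF B P Av] col_W[OF k] by simp
    finally show "col (P * A * W) k = col (B * P * W) k" .
  qed (use A B P W in auto)
  \<comment> \<open>\<open>invertible_mat\<close> does not fix the shape of the inverse; comparing
    the numbers of columns in both products shows that \<open>V\<close> is square of size
    \<open>n\<close>.\<close>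
  obtain V where WV: "W * V = 1\<^sub>m n" and "V * W = 1\<^sub>m (dim_row V)"
    using inv W unfolding W_def[symmetric] invertible_mat_def inverts_mat_def by auto
  then have V: "V \<in> carrier_mat n n"
    using W by (metis carrier_matI carrier_matD(2) index_mult_mat(3) index_one_mat(3))
  have "P * A = P * A * W * V"
    using assoc_mult_mat[OF PA W V] right_mult_one_mat[OF PA] WV by simp
  also have "\<dots> = B * P * W * V"
    using \<open>P * A * W = B * P * W\<close> by simp
  also have "\<dots> = B * P"
    using assoc_mult_mat[OF BP W V] right_mult_one_mat[OF BP] WV by simp
  finally show ?thesis .
qed

text \<open>Both products are evaluated at \<open>(i, p j)\<close>. Row \<open>i\<close> of the
  permutation matrix has its only 1 in column \<open>p i\<close>, and column \<open>p j\<close> has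
  its only 1 in row \<open>j\<close> because \<open>p\<close> is injective, so each sum collapses to
  one entry.\<close>

lemma permutation_intertwining_entries:
  fixes A B :: "'a :: semiring_1 mat"
  assumes A: "A \<in> carrier_mat n n" and B: "B \<in> carrier_mat n n"
    and p: "p permutes {..<n}"
    and comm: "mat n n (\<lambda>(i, j). if j = p i then 1 else 0) * A
      = B * mat n n (\<lambda>(i, j). if j = p i then 1 else 0)"
    and i: "i < n" and j: "j < n"
  shows "A $$ (p i, p j) = B $$ (i, j)"
proof -
  define P :: "'a mat" where "P = mat n n (\<lambda>(i, j). if j = p i then 1 else 0)"
  have pn: "p k < n" if "k < n" for k
    using permutes_in_image[OF p, of k] that by simp
  have eq_iff: "p j = p k \<longleftrightarrow> j = k" for k
    using permutes_inj[OF p] by (auto dest: injD)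
  have "(P * A) $$ (i, p j) = A $$ (p i, p j)"
    using A i j pn by (simp add: P_def scalar_prod_def
        if_distrib[where f = "\<lambda>x. x * y" for y] cong: if_cong)
  moreover have "(B * P) $$ (i, p j) = B $$ (i, j)"
    using B i j pn by (simp add: P_def scalar_prod_def eq_iff
        if_distrib[where f = "(*) x" for x] cong: if_cong)
  ultimately show ?thesis
    using comm unfolding P_def by simp
qed

text \<open>An isomorphism in \<open>digraph_iso\<close> also needs a map on arcs. Without multiple
  arcs an arc is determined by its ends, so the vertex bijection induces this map.\<close>

lemma digraph_isoI_dominates:
  assumes "nomulti_digraph G" and "nomulti_digraph H"
    and f: "bij_betw f (verts G) (verts H)"
    and adj: "\<And>u v. u \<in> verts G \<Longrightarrow> v \<in> verts G \<Longrightarrow> f u \<rightarrow>\<^bsub>H\<^esub> f v \<longleftrightarrow> u \<rightarrow>\<^bsub>G\<^esub> v"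
  shows "digraph_iso G H"
proof -
  interpret G: nomulti_digraph G by fact
  interpret H: nomulti_digraph H by fact
  \<comment> \<open>An arc goes to the arc of \<open>H\<close> whose ends are the
    \<open>f\<close>-images of its ends; it is unique since \<open>arc_to_ends H\<close> is
    injective on the arcs.\<close>
  define g where "g = the_inv_into (arcs H) (arc_to_ends H) \<circ> map_prod f f \<circ> arc_to_ends G"
  have ends_g: "arc_to_ends H (g a) = map_prod f f (arc_to_ends G a)" and g_in: "g a \<in> arcs H"
    if a: "a \<in> arcs G" for a
  proof -
    have "tail G a \<rightarrow>\<^bsub>G\<^esub> head G a"
      using a by (auto simp: arcs_ends_conv)
    \<comment> \<open>The inverse in \<open>g\<close> is meaningful only on the range of
      \<open>arc_to_ends H\<close>; preservation of adjacency puts the pair there.\<close>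
    then have "map_prod f f (arc_to_ends G a) \<in> arc_to_ends H ` arcs H"
      using adj[of "tail G a" "head G a"] a by (simp add: arc_to_ends_def arcs_ends_def)
    then show "arc_to_ends H (g a) = map_prod f f (arc_to_ends G a)" "g a \<in> arcs H"
      unfolding g_def
      by (auto intro: f_the_inv_into_f the_inv_into_into H.inj_on_arc_to_ends)
  qed
  have inj_f: "inj_on f (verts G)" and f_img: "f ` verts G = verts H"
    using f by (auto simp: bij_betw_def)
  have "inj_on g (arcs G)"
  proof (rule inj_onI)
    fix a b assume ab: "a \<in> arcs G" "b \<in> arcs G" and "g a = g b"
    then have "map_prod f f (arc_to_ends G a) = map_prod f f (arc_to_ends G b)"
      using ends_g by metis
    then have "arc_to_ends G a = arc_to_ends G b"
      using inj_onD[OF inj_f] ab by (simp add: arc_to_ends_def)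
    then show "a = b" using ab G.no_multi_arcs by blast
  qed
  \<comment> \<open>Surjectivity uses the other direction of \<open>adj\<close>: the ends of an arc
    of \<open>H\<close> pull back to adjacent vertices of \<open>G\<close>.\<close>
  moreover have "arcs H \<subseteq> g ` arcs G"
  proof
    fix b assume b: "b \<in> arcs H"
    obtain u v where uv: "u \<in> verts G" "v \<in> verts G" "tail H b = f u" "head H b = f v"
      using H.tail_in_verts[OF b] H.head_in_verts[OF b] f_img by (metis imageE)
    have "f u \<rightarrow>\<^bsub>H\<^esub> f v"
      using b uv by (auto simp: arcs_ends_conv intro: rev_image_eqI)
    then obtain a where a: "a \<in> arcs G" "arc_to_ends G a = (u, v)"
      using adj uv by (auto simp: arcs_ends_def)
    then have "arc_to_ends H (g a) = arc_to_ends H b"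
      using ends_g uv by (simp add: arc_to_ends_def)
    then show "b \<in> g ` arcs G"
      using H.no_multi_arcs g_in a b by blast
  qed
  \<comment> \<open>\<open>app_iso\<close> takes its head and tail functions from the isomorphism,
    so choosing those of \<open>H\<close> makes the image equal to \<open>H\<close> as a
    record.\<close>
  ultimately have "pre_digraph.digraph_isomorphism G
        \<lparr>iso_verts = f, iso_arcs = g, iso_head = head H, iso_tail = tail H\<rparr>"
    and "H = app_iso \<lparr>iso_verts = f, iso_arcs = g, iso_head = head H, iso_tail = tail H\<rparr> G"
    using inj_f f_img g_in ends_g G.wf_digraph
    by (auto simp: pre_digraph.digraph_isomorphism_def arc_to_ends_def
        intro!: pre_digraph.equality)
  then show ?thesis unfolding digraph_iso_def by blast
qed

lemma adjacency_mat_carrier: "adjacency_mat vs G \<in> carrier_mat (length vs) (length vs)"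
  by (simp add: adjacency_mat_def)

lemma digraph_iso_of_adjacency_mat:
  assumes "nomulti_digraph G" and "nomulti_digraph H"
    and us: "vertex_numbering us G" and vs: "vertex_numbering vs H"
    and len: "length us = n" "length vs = n"
    and p: "p permutes {..<n}"
    and entries: "\<And>i j. i < n \<Longrightarrow> j < n \<Longrightarrow>
      adjacency_mat us G $$ (p i, p j) = adjacency_mat vs H $$ (i, j)"
  shows "digraph_iso G H"
proof -
  have bij_us: "bij_betw ((!) us) {..<n} (verts G)" and bij_vs: "bij_betw ((!) vs) {..<n} (verts H)"
    using us vs len by (auto simp: vertex_numbering_def intro!: bij_betw_nth)
  have bij_up: "bij_betw (\<lambda>i. us ! p i) {..<n} (verts G)"
    using bij_betw_trans[OF permutes_imp_bij[OF p] bij_us] by (simp add: comp_def)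
  \<comment> \<open>Position \<open>p i\<close> of \<open>us\<close> is matched with position
    \<open>i\<close> of \<open>vs\<close>, as the indices in \<open>entries\<close> dictate.\<close>
  define f where "f = (!) vs \<circ> the_inv_into {..<n} (\<lambda>i. us ! p i)"
  have f: "bij_betw f (verts G) (verts H)"
    unfolding f_def using bij_betw_trans[OF bij_betw_the_inv_into[OF bij_up] bij_vs] .
  have f_nth: "f (us ! p i) = vs ! i" if "i < n" for i
    unfolding f_def comp_def
    using the_inv_into_f_f[OF bij_betw_imp_inj_on[OF bij_up], of i] that by simp
  show ?thesis
  proof (rule digraph_isoI_dominates[OF assms(1,2) f])
    fix u v assume "u \<in> verts G" and "v \<in> verts G"
    then obtain i j where ij: "i < n" "j < n" "u = us ! p i" "v = us ! p j"
      unfolding bij_betw_imp_surj_on[OF bij_up, symmetric] by auto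
    \<comment> \<open>The entry \<open>(p i, p j)\<close> encodes adjacency only when both indices
      are within the matrix.\<close>
    have "p i < n" "p j < n"
      using permutes_in_image[OF p, of i] permutes_in_image[OF p, of j] ij by simp_all
    then show "f u \<rightarrow>\<^bsub>H\<^esub> f v \<longleftrightarrow> u \<rightarrow>\<^bsub>G\<^esub> v"
      using entries[OF ij(1,2)] ij len f_nth by (simp add: adjacency_mat_def split: if_splits)
  qed
qed

theorem mainTheorem3:
  fixes G :: "('a, 'b) pre_digraph" and H :: "('c, 'd) pre_digraph" and n :: nat
    and us :: "'a list" and vs :: "'c list"
  assumes "graph G" and "graph H"
    and "card (verts G) = n" and "card (verts H) = n"
    and "vertex_numbering us G" and "vertex_numbering vs H"
    and "controllable us G" and "controllable vs H"
    and "\<exists>P. permutation_mat n P \<and> P * extended_walk_mat us G = extended_walk_mat vs H"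
  shows "digraph_iso G H"
proof -
  have len: "length us = n" "length vs = n"
    using assms(3-6) distinct_card[of us] distinct_card[of vs]
    by (simp_all add: vertex_numbering_def)
  define A B where "A = adjacency_mat us G" and "B = adjacency_mat vs H"
  have A: "A \<in> carrier_mat n n" and B: "B \<in> carrier_mat n n"
    using adjacency_mat_carrier[of us G] adjacency_mat_carrier[of vs H] len
    by (simp_all add: A_def B_def)
  have one: "all_ones_vec n \<in> carrier_vec n"
    by (simp add: all_ones_vec_def)
  obtain p where p: "p permutes {..<n}"
    and eq: "mat n n (\<lambda>(i, j). if j = p i then 1 else 0) * extended_walk_mat us G
      = extended_walk_mat vs H"
    using assms(9) unfolding permutation_mat_def by blast
  define P :: "real mat" where "P = mat n n (\<lambda>(i, j). if j = p i then 1 else 0)"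
  have P: "P \<in> carrier_mat n n"
    by (simp add: P_def)
  \<comment> \<open>The list has \<open>n + 1\<close> entries, so \<open>k = n\<close> is a
    legitimate column index.\<close>
  have col_ext: "col (mat_of_cols n (map (\<lambda>k. C ^\<^sub>m k *\<^sub>v all_ones_vec n) [0..<n + 1])) k
      = C ^\<^sub>m k *\<^sub>v all_ones_vec n"
    if "k \<le> n" "C \<in> carrier_mat n n" for C k
    using that mult_mat_vec_carrier[OF pow_carrier_mat[OF that(2)] one]
    by (subst col_mat_of_cols) (auto simp del: upt_Suc)
  have comm: "P * A = B * P"
  proof (rule intertwining_of_krylov[OF A B P one one])
    show "invertible_mat (mat_of_cols n (map (\<lambda>k. A ^\<^sub>m k *\<^sub>v all_ones_vec n) [0..<n]))"
      using assms(7) len by (simp add: controllable_def walk_mat_def A_def)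
  next
    fix k assume k: "k \<le> n"
    have ext: "extended_walk_mat us G \<in> carrier_mat n (n + 1)"
      using mat_of_cols_carrier(1)[of n "map (\<lambda>k. A ^\<^sub>m k *\<^sub>v all_ones_vec n) [0..<n + 1]"]
      unfolding extended_walk_mat_def len A_def by (simp del: upt_Suc)
    \<comment> \<open>Left multiplication acts column by column, so the matrix equation splits into
      one vector equation for each exponent up to \<open>n\<close>.\<close>
    have "P *\<^sub>v col (extended_walk_mat us G) k = col (extended_walk_mat vs H) k"
      using col_mult2[OF P ext, of k] k eq[folded P_def] by (metis Suc_eq_plus1 le_imp_less_Suc)
    then show "P *\<^sub>v (A ^\<^sub>m k *\<^sub>v all_ones_vec n) = B ^\<^sub>m k *\<^sub>v all_ones_vec n"
      unfolding extended_walk_mat_def len A_def[symmetric] B_def[symmetric]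
        col_ext[OF k A] col_ext[OF k B] .
  qed
  interpret G: graph G by fact
  interpret H: graph H by fact
  show ?thesis
    using permutation_intertwining_entries[OF A B p comm[unfolded P_def]]
    by (intro digraph_iso_of_adjacency_mat[OF G.nomulti_digraph H.nomulti_digraph
          assms(5,6) len p]) (simp add: A_def B_def)
qed

end
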